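(* Let $0<\lambda\le1$ and let $f(z)=z+\sum_{n\ge2}a_nz^n\in\mathcal{ST}_{ss}(\lambda)$. Then $$|a_2a_4-a_3^2|\le\frac{\lambda^2}{4},$$ and the inequality is sharp.
   Context: $\mathbb{D}=\{z\in\mathbb{C}:|z|<1\}$. $\mathcal{A}$ is the class of holomorphic functions in $\mathbb{D}$ of the form $f(z)=z+\sum_{n\ge 2}a_nz^n$. $\mathcal{ST}$ is the class of univalent $f\in\mathcal{A}$ with $\Re\{zf'(z)/f(z)\}>0$ in $\mathbb{D}$. For $0<\lambda\le1$, $\mathcal{ST}_{ss}(\lambda)$ is the subfamily of $f\in\mathcal{ST}$ satisfying $zf'(z)/f(z)\prec(1+z)^\lambda$ in $\mathbb{D}$, where the branch of the power equals $1$ at $z=0$ and $p\prec q$ (subordination) means $p=q\circ\omega$ for some analytic $\omega:\mathbb{D}\to\mathbb{D}$ with $\omega(0)=0$. "Sharp" means that, for given $\lambda$, the bound cannot be replaced by a smaller one for the class considered. *)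

theory Defs
  imports "HOL-Complex_Analysis.Complex_Analysis"
begin

text \<open>
  Functions on the open unit disc are total functions of which only the values on
  \<^term>\<open>ball (0::complex) 1\<close> matter.
\<close>

abbreviation unit_disc :: "complex set" where
  "unit_disc \<equiv> ball 0 1"

text \<open>
  The expansion $f(z) = z + \sum_{n \ge 2} a_n z^n$ on the unit disc. The entries
  \<^term>\<open>a 0\<close> and \<^term>\<open>a 1\<close> of the sequence play no role.
\<close>

definition has_normalized_expansion ::
    "(complex \<Rightarrow> complex) \<Rightarrow> (nat \<Rightarrow> complex) \<Rightarrow> bool" where
  "has_normalized_expansion f a \<longleftrightarrow>
     (\<forall>z\<in>unit_disc. (\<lambda>n. a (n + 2) * z ^ (n + 2)) sums (f z - z))"

definition class_A :: "(complex \<Rightarrow> complex) set" where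
  "class_A = {f. f holomorphic_on unit_disc \<and> (\<exists>a. has_normalized_expansion f a)}"

text \<open>
  The function $z f'(z) / f(z)$; at the origin, where the formula reads $0/0$, it
  takes the value $1$ that removes the singularity for normalized $f$.
\<close>

definition starlike_quotient :: "(complex \<Rightarrow> complex) \<Rightarrow> complex \<Rightarrow> complex" where
  "starlike_quotient f z = (if z = 0 then 1 else z * deriv f z / f z)"

definition class_ST :: "(complex \<Rightarrow> complex) set" where
  "class_ST = {f \<in> class_A. inj_on f unit_disc \<and>
     (\<forall>z\<in>unit_disc. Re (starlike_quotient f z) > 0)}"

definition subordinate :: "(complex \<Rightarrow> complex) \<Rightarrow> (complex \<Rightarrow> complex) \<Rightarrow> bool" where
  "subordinate p q \<longleftrightarrow>
     (\<exists>\<omega>. \<omega> holomorphic_on unit_disc \<and> \<omega> ` unit_disc \<subseteq> unit_disc \<and> \<omega> 0 = 0 \<and>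
          (\<forall>z\<in>unit_disc. p z = q (\<omega> z)))"

text \<open>
  Since $1 + z$ lies in the right half-plane for $z$ in the unit disc, the principal
  power below is holomorphic there, and it equals $1$ at $z = 0$.
\<close>

definition class_ST_ss :: "real \<Rightarrow> (complex \<Rightarrow> complex) set" where
  "class_ST_ss l = {f \<in> class_ST.
     subordinate (starlike_quotient f) (\<lambda>z. (1 + z) powr of_real l)}"

end

theory Submission
  imports Defs
begin

text \<open>
  Write $z f'(z)/f(z) = q(z) = (1 + \omega(z))^\lambda$ with a Schwarz function
  $\omega(z) = c_1 z + c_2 z^2 + c_3 z^3 + \dots$. The two differential equations
  $z f' = q f$ and $(1 + \omega) q' = \lambda \omega' q$ determine first the coefficients of $q$
  and then those of $f$, and give (\<open>Hankel_determinant_formula\<close>)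
  \[ a_2 a_4 - a_3^2 = \frac{\lambda^2}{12} \Bigl(4 c_1 c_3 - 3 c_2^2 + (\lambda - 1) c_1^2 c_2
       + \frac{(1 + \lambda)(7 - 13 \lambda)}{12} c_1^4\Bigr). \]
  It remains to bound the bracket by $3$ over all Schwarz functions.

  By Schur's algorithm (\<open>Schwarz_function_coefficients\<close>) the possible coefficients are
  $c_1 = c$, $c_2 = (1 - |c|^2) x$, $c_3 = (1 - |c|^2)((1 - |x|^2) y - \bar c x^2)$ with $c, x, y$
  in the closed unit disc. After the triangle inequality the estimate depends on $|c|$ and $|x|$
  only; it increases with $|x|$, and at $|x| = 1$ it is
  $3 - (1 + \lambda) |c|^2 - (1 - \lambda) |c|^4$ (\<open>hankel_numerator_bound\<close>).

  The value $3$ is reached for $c = 0$ and $|x| = 1$, that is, for $\omega(z) = z^2$. The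
  corresponding $f$ is $z \exp g(z)$ with $z g'(z) = q(z) - 1$, and what needs an argument is that
  it is univalent. In the logarithmic coordinate $z = e^\zeta$ it becomes
  $\zeta \mapsto \zeta + g(e^\zeta)$, whose derivative $q(e^\zeta)$ has positive real part on a half
  plane, and such functions are injective on convex sets (\<open>starlike_imp_inj_on\<close>).
\<close>

section \<open>Coefficients of bounded functions\<close>

lemma fps_eq_if_eq_on_disc:
  fixes f g :: "complex \<Rightarrow> complex"
  assumes "f has_fps_expansion F" and "g has_fps_expansion G"
    and "\<And>z. z \<in> unit_disc \<Longrightarrow> f z = g z"
  shows "F = G"
proof -
  have "eventually (\<lambda>z::complex. z \<in> unit_disc) (nhds 0)"
    by (intro eventually_nhds_in_open) auto
  then have "eventually (\<lambda>z. f z = g z) (nhds 0)"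
    by (rule eventually_mono) (use assms(3) in auto)
  then have "g has_fps_expansion F"
    using assms(1) has_fps_expansion_cong[of f g F F] by simp
  then show ?thesis
    using assms(2) fps_expansion_unique_complex by blast
qed

text \<open>
  One step of Schur's algorithm. If $|\phi| < 1$, then composing $\phi$ with the disc automorphism
  that sends $\phi(0)$ to $0$ gives a function $\psi$ to which Schwarz's lemma applies, and
  $\kappa(z) = \psi(z)/z$. Multiplying out the denominator makes the identity meaningful also for
  unimodular constants $\phi$, where $\kappa = 0$ serves; the step can thus be iterated without
  distinguishing cases.
\<close>

lemma Schur_step:
  assumes hol: "\<phi> holomorphic_on unit_disc"
    and le1: "\<And>z. z \<in> unit_disc \<Longrightarrow> norm (\<phi> z) \<le> 1"
  obtains \<kappa> where "\<kappa> holomorphic_on unit_disc"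
    and "\<And>z. z \<in> unit_disc \<Longrightarrow> norm (\<kappa> z) \<le> 1"
    and "\<And>z. z \<in> unit_disc \<Longrightarrow> \<phi> z - \<phi> 0 = z * \<kappa> z * (1 - cnj (\<phi> 0) * \<phi> z)"
proof (cases "\<exists>w\<in>unit_disc. norm (\<phi> w) = 1")
  case True
  then obtain w where w: "w \<in> unit_disc" "norm (\<phi> w) = 1"
    by blast
  have "\<phi> constant_on unit_disc"
  proof (rule maximum_modulus_principle[OF hol open_ball _ open_ball subset_refl w(1)])
    show "connected unit_disc"
      by (intro convex_connected convex_ball)
    show "norm (\<phi> z) \<le> norm (\<phi> w)" if "z \<in> unit_disc" for z
      using le1[OF that] w(2) by simp
  qed
  then have const: "\<phi> z - \<phi> 0 = 0" if "z \<in> unit_disc" for z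
  proof -
    obtain k where "\<And>z. z \<in> unit_disc \<Longrightarrow> \<phi> z = k"
      using \<open>\<phi> constant_on unit_disc\<close> unfolding constant_on_def by blast
    from this[OF that] this[of 0] show ?thesis
      by simp
  qed
  show ?thesis
    by (rule that[of "\<lambda>_. 0"]) (simp_all add: const)
next
  case False
  define d where "d = \<phi> 0"
  have lt1: "norm (\<phi> z) < 1" if "norm z < 1" for z
    using le1[of z] False that by (auto simp: less_le)
  have d1: "norm d < 1"
    unfolding d_def by (rule lt1) simp
  have den: "1 - cnj d * \<phi> z \<noteq> 0" if "norm z < 1" for z
  proof
    assume "1 - cnj d * \<phi> z = 0"
    then have "norm (cnj d * \<phi> z) = 1"
      by simp
    then have "norm d * norm (\<phi> z) = 1"
      by (simp add: norm_mult)
    moreover have "norm d * norm (\<phi> z) < 1 * 1"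
      using d1 lt1[OF that] by (intro mult_strict_mono') auto
    ultimately show False by simp
  qed
  define \<psi> where "\<psi> z = (\<phi> z - d) / (1 - cnj d * \<phi> z)" for z
  have \<psi>hol: "\<psi> holomorphic_on ball 0 1"
    unfolding \<psi>_def using den by (intro holomorphic_intros hol) auto
  have \<psi>0: "\<psi> 0 = 0"
    by (simp add: \<psi>_def d_def)
  have \<psi>1: "norm (\<psi> z) < 1" if "norm z < 1" for z
  proof -
    have "\<psi> z = Moebius_function 0 d (\<phi> z)"
      by (simp add: \<psi>_def Moebius_function_simple)
    then show ?thesis
      using Moebius_function_norm_lt_1[OF d1 lt1[OF that]] by simp
  qed
  obtain \<kappa> where \<kappa>hol: "\<kappa> holomorphic_on ball 0 1"
    and \<kappa>: "\<And>z. norm z < 1 \<Longrightarrow> \<psi> z = z * \<kappa> z" and \<kappa>0: "deriv \<psi> 0 = \<kappa> 0"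
    using Schwarz3[OF \<psi>hol \<psi>0] by blast
  have "norm (\<kappa> z) \<le> 1" if z: "norm z < 1" for z
  proof (cases "z = 0")
    case True
    then show ?thesis
      using Schwarz_Lemma(2)[OF \<psi>hol \<psi>0 \<psi>1 z] \<kappa>0 by simp
  next
    case False
    have "norm z * norm (\<kappa> z) \<le> norm z * 1"
      using Schwarz_Lemma(1)[OF \<psi>hol \<psi>0 \<psi>1 z] \<kappa>[OF z] by (simp add: norm_mult)
    then show ?thesis
      using False mult_le_cancel_left_pos[of "norm z" "norm (\<kappa> z)" 1] by simp
  qed
  moreover have "\<phi> z - d = z * \<kappa> z * (1 - cnj d * \<phi> z)" if "norm z < 1" for z
  proof -
    have "\<phi> z - d = \<psi> z * (1 - cnj d * \<phi> z)"
      using den[OF that] by (simp add: \<psi>_def)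
    then show ?thesis
      using \<kappa>[OF that] by simp
  qed
  ultimately show ?thesis
    by (intro that[of \<kappa>]) (use \<kappa>hol d_def in auto)
qed

lemma Schur_step_fps:
  assumes hol: "\<phi> holomorphic_on unit_disc"
    and le1: "\<And>z. z \<in> unit_disc \<Longrightarrow> norm (\<phi> z) \<le> 1"
    and F: "\<phi> has_fps_expansion F"
  obtains \<kappa> G where "\<kappa> holomorphic_on unit_disc"
    and "\<And>z. z \<in> unit_disc \<Longrightarrow> norm (\<kappa> z) \<le> 1"
    and "\<kappa> has_fps_expansion G"
    and "F - fps_const (fps_nth F 0) = fps_X * G * (1 - fps_const (cnj (fps_nth F 0)) * F)"
proof -
  obtain \<kappa> where \<kappa>: "\<kappa> holomorphic_on unit_disc"
    "\<And>z. z \<in> unit_disc \<Longrightarrow> norm (\<kappa> z) \<le> 1"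
    "\<And>z. z \<in> unit_disc \<Longrightarrow> \<phi> z - \<phi> 0 = z * \<kappa> z * (1 - cnj (\<phi> 0) * \<phi> z)"
    using Schur_step[OF hol le1] by blast
  have G: "\<kappa> has_fps_expansion fps_expansion \<kappa> 0"
    by (rule has_fps_expansion_fps_expansion[OF _ _ \<kappa>(1)]) auto
  have F0: "\<phi> 0 = fps_nth F 0"
    using fps_nth_fps_expansion[OF F, of 0] by simp
  have "F - fps_const (\<phi> 0) = fps_X * fps_expansion \<kappa> 0 * (1 - fps_const (cnj (\<phi> 0)) * F)"
  proof (rule fps_eq_if_eq_on_disc)
    show "(\<lambda>z. \<phi> z - \<phi> 0) has_fps_expansion F - fps_const (\<phi> 0)"
      by (intro fps_expansion_intros F)
    show "(\<lambda>z. z * \<kappa> z * (1 - cnj (\<phi> 0) * \<phi> z)) has_fps_expansion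
            fps_X * fps_expansion \<kappa> 0 * (1 - fps_const (cnj (\<phi> 0)) * F)"
      by (intro fps_expansion_intros F G)
  qed (use \<kappa>(3) in auto)
  then show ?thesis
    using that[OF \<kappa>(1,2) G] F0 by simp
qed

text \<open>
  Three Schur steps. The first one, from $\omega(0) = 0$, just divides by $z$; the parameters
  $c$, $x$, $y$ are the values at the origin of the successive quotients.
\<close>

lemma Schwarz_function_coefficients:
  assumes hol: "\<omega> holomorphic_on unit_disc" and im: "\<omega> ` unit_disc \<subseteq> unit_disc"
    and W: "\<omega> has_fps_expansion W" and W0: "fps_nth W 0 = 0"
  obtains c x y :: complex where "norm c \<le> 1" "norm x \<le> 1" "norm y \<le> 1"
    and "fps_nth W 1 = c"
    and "fps_nth W 2 = of_real (1 - (norm c)\<^sup>2) * x"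
    and "fps_nth W 3 = of_real (1 - (norm c)\<^sup>2) * (of_real (1 - (norm x)\<^sup>2) * y - cnj c * x\<^sup>2)"
proof -
  have nth: "fps_nth (fps_X * F) (Suc n) = fps_nth F n" for F :: "complex fps" and n
    by simp
  have "norm (\<omega> z) \<le> 1" if "z \<in> unit_disc" for z
    using im that by (auto simp: image_subset_iff less_imp_le)
  from Schur_step_fps[OF hol this W]
  obtain \<phi> F where \<phi>: "\<phi> holomorphic_on unit_disc"
    "\<And>z. z \<in> unit_disc \<Longrightarrow> norm (\<phi> z) \<le> 1" "\<phi> has_fps_expansion F"
    and "W - fps_const (fps_nth W 0) = fps_X * F * (1 - fps_const (cnj (fps_nth W 0)) * W)"
    by metis
  then have WF: "W = fps_X * F"
    by (simp add: W0)
  obtain \<kappa> G where \<kappa>: "\<kappa> holomorphic_on unit_disc"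
    "\<And>z. z \<in> unit_disc \<Longrightarrow> norm (\<kappa> z) \<le> 1" "\<kappa> has_fps_expansion G"
    and FG: "F - fps_const (fps_nth F 0) = fps_X * G * (1 - fps_const (cnj (fps_nth F 0)) * F)"
    using Schur_step_fps[OF \<phi>] by blast
  obtain \<xi> E where \<xi>: "\<xi> holomorphic_on unit_disc"
    "\<And>z. z \<in> unit_disc \<Longrightarrow> norm (\<xi> z) \<le> 1" "\<xi> has_fps_expansion E"
    and GE: "G - fps_const (fps_nth G 0) = fps_X * E * (1 - fps_const (cnj (fps_nth G 0)) * G)"
    using Schur_step_fps[OF \<kappa>] by blast
  define c x y where "c = fps_nth F 0" and "x = fps_nth G 0" and "y = fps_nth E 0"
  have "c = \<phi> 0" "x = \<kappa> 0" "y = \<xi> 0"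
    using fps_nth_fps_expansion[OF \<phi>(3), of 0] fps_nth_fps_expansion[OF \<kappa>(3), of 0]
      fps_nth_fps_expansion[OF \<xi>(3), of 0] by (simp_all add: c_def x_def y_def)
  then have norms: "norm c \<le> 1" "norm x \<le> 1" "norm y \<le> 1"
    using \<phi>(2)[of 0] \<kappa>(2)[of 0] \<xi>(2)[of 0] by auto
  have sq: "of_real (1 - (norm v)\<^sup>2) = 1 - v * cnj v" for v :: complex
    using complex_norm_square[of v] by simp
  have G1: "fps_nth G 1 = y * (1 - x * cnj x)"
    using arg_cong[OF GE, of "\<lambda>H. fps_nth H 1"]
    by (simp add: x_def y_def mult.assoc nth fps_mult_nth algebra_simps)
  have F1: "fps_nth F 1 = x * (1 - c * cnj c)"
    using arg_cong[OF FG, of "\<lambda>H. fps_nth H 1"]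
    by (simp add: x_def c_def mult.assoc nth fps_mult_nth algebra_simps)
  have "fps_nth F 2 = fps_nth G 1 * (1 - cnj c * c) - x * cnj c * fps_nth F 1"
    using arg_cong[OF FG, of "\<lambda>H. fps_nth H 2"]
    unfolding numeral_2_eq_2 mult.assoc fps_sub_nth nth
    by (simp add: x_def c_def fps_mult_nth algebra_simps)
  then have F2: "fps_nth F 2 = (1 - c * cnj c) * ((1 - x * cnj x) * y - cnj c * x\<^sup>2)"
    unfolding G1 F1 by (simp add: algebra_simps power2_eq_square)
  show ?thesis
  proof (rule that[OF norms], unfold sq)
    show "fps_nth W 1 = c"
      by (simp add: WF c_def)
    show "fps_nth W 2 = (1 - c * cnj c) * x"
      using F1 by (simp add: WF numeral_2_eq_2 mult.commute)
    show "fps_nth W 3 = (1 - c * cnj c) * ((1 - x * cnj x) * y - cnj c * x\<^sup>2)"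
      using F2 by (simp add: WF numeral_3_eq_3 numeral_2_eq_2)
  qed
qed

section \<open>The determinant in terms of the subordinating function\<close>

lemma has_normalized_expansion_imp_fps:
  assumes "has_normalized_expansion f a"
  shows "f has_fps_expansion Abs_fps (\<lambda>n. if n = 0 then 0 else if n = 1 then 1 else a n)"
    (is "_ has_fps_expansion Abs_fps ?b")
proof (rule has_fps_expansionI)
  have "(\<lambda>n. ?b n * z ^ n) sums f z" if "z \<in> unit_disc" for z
  proof -
    have "(\<lambda>n. ?b (n + 2) * z ^ (n + 2)) sums (f z - (\<Sum>i<2. ?b i * z ^ i))"
      using assms that by (simp add: has_normalized_expansion_def numeral_2_eq_2)
    then show ?thesis
      using sums_iff_shift[of "\<lambda>n. ?b n * z ^ n" 2 "f z - (\<Sum>i<2. ?b i * z ^ i)"]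
      by (simp only: diff_add_cancel)
  qed
  moreover have "eventually (\<lambda>z::complex. z \<in> unit_disc) (nhds 0)"
    by (intro eventually_nhds_in_open) auto
  ultimately show "eventually (\<lambda>u. (\<lambda>n. fps_nth (Abs_fps ?b) n * u ^ n) sums f u) (nhds 0)"
    by (auto elim: eventually_mono)
qed

text \<open>
  The differential equation replaces the binomial series: coefficients of
  $(1 + \omega)^\lambda$ follow from it recursively, without composing power series.
\<close>

lemma powr_of_bounded_holomorphic:
  fixes l :: real
  assumes hol: "\<omega> holomorphic_on unit_disc" and im: "\<omega> ` unit_disc \<subseteq> unit_disc"
  defines "q \<equiv> \<lambda>z. (1 + \<omega> z) powr of_real l"
  shows "q holomorphic_on unit_disc"
    and "z \<in> unit_disc \<Longrightarrow> (1 + \<omega> z) * deriv q z = of_real l * deriv \<omega> z * q z"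
proof -
  have nonpos: "1 + \<omega> z \<notin> \<real>\<^sub>\<le>\<^sub>0" if "z \<in> unit_disc" for z
  proof -
    have "\<bar>Re (\<omega> z)\<bar> < 1"
      using im that abs_Re_le_cmod[of "\<omega> z"] by (force simp: image_subset_iff)
    then show ?thesis
      by (auto simp: complex_nonpos_Reals_iff)
  qed
  then show "q holomorphic_on unit_disc"
    unfolding q_def by (intro holomorphic_intros hol) auto
  assume z: "z \<in> unit_disc"
  have d: "(\<omega> has_field_derivative deriv \<omega> z) (at z)"
    using hol z by (intro holomorphic_derivI) auto
  have d1: "((\<lambda>z. 1 + \<omega> z) has_field_derivative deriv \<omega> z) (at z)"
    using DERIV_add[OF DERIV_const d] by simp
  have "(q has_field_derivative of_real l * (1 + \<omega> z) powr (of_real l - 1) * deriv \<omega> z) (at z)"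
    unfolding q_def using DERIV_chain2[OF has_field_derivative_powr[OF nonpos[OF z]] d1] by simp
  then have "deriv q z = of_real l * (1 + \<omega> z) powr (of_real l - 1) * deriv \<omega> z"
    by (rule DERIV_imp_deriv)
  moreover have "(1 + \<omega> z) * (1 + \<omega> z) powr (of_real l - 1) = q z"
    using nonpos[OF z] by (auto simp: q_def powr_diff)
  ultimately show "(1 + \<omega> z) * deriv q z = of_real l * deriv \<omega> z * q z"
    by (simp add: mult_ac)
qed

text \<open>
  The bracket in the formula for the determinant, as a polynomial in the first three coefficients
  of the Schwarz function.
\<close>

definition hankel_numerator :: "real \<Rightarrow> complex \<Rightarrow> complex \<Rightarrow> complex \<Rightarrow> complex" where
  "hankel_numerator l c1 c2 c3 =
     4 * c1 * c3 - 3 * c2\<^sup>2 + of_real (l - 1) * (c1\<^sup>2 * c2)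
     + of_real ((1 + l) * (7 - 13 * l) / 12) * c1 ^ 4"

text \<open>
  Comparing coefficients in $z f' = q f$ and $(1 + \omega) q' = \lambda \omega' q$. Univalence of
  \<open>f\<close> enters because the first equation comes from dividing by $f(z)$, which must not vanish for
  $z \neq 0$.
\<close>

lemma Hankel_determinant_formula:
  assumes f: "f \<in> class_ST" and a: "has_normalized_expansion f a"
    and hol: "\<omega> holomorphic_on unit_disc" and im: "\<omega> ` unit_disc \<subseteq> unit_disc"
    and W: "\<omega> has_fps_expansion W" and W0: "fps_nth W 0 = 0"
    and sub: "\<And>z. z \<in> unit_disc \<Longrightarrow> starlike_quotient f z = (1 + \<omega> z) powr of_real l"
  shows "a 2 * a 4 - (a 3)\<^sup>2 =
    of_real (l\<^sup>2 / 12) * hankel_numerator l (fps_nth W 1) (fps_nth W 2) (fps_nth W 3)"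
proof -
  define q where "q z = (1 + \<omega> z) powr of_real l" for z
  define F where "F = Abs_fps (\<lambda>n. if n = 0 then 0 else if n = 1 then 1 else a n)"
  define Q where "Q = fps_expansion q 0"
  have qhol: "q holomorphic_on unit_disc"
    using powr_of_bounded_holomorphic(1)[OF hol im] by (simp add: q_def[abs_def])
  have F: "f has_fps_expansion F"
    unfolding F_def by (rule has_normalized_expansion_imp_fps[OF a])
  have Q: "q has_fps_expansion Q"
    unfolding Q_def by (rule has_fps_expansion_fps_expansion[OF _ _ qhol]) auto
  have f0: "f 0 = 0"
    using fps_nth_fps_expansion[OF F, of 0] by (simp add: F_def)
  have w0: "\<omega> 0 = 0"
    using fps_nth_fps_expansion[OF W, of 0] W0 by simp
  have Q0: "fps_nth Q 0 = 1"
    using fps_nth_fps_expansion[OF Q, of 0] by (simp add: q_def w0)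
  have ode_f: "z * deriv f z = q z * f z" if z: "z \<in> unit_disc" for z
  proof (cases "z = 0")
    case False
    have "f z \<noteq> f 0"
      using f False z by (auto simp: class_ST_def inj_on_def)
    then show ?thesis
      using sub[OF z] False f0 by (auto simp: q_def starlike_quotient_def field_simps)
  qed (simp add: f0)
  have E1: "fps_X * fps_deriv F = Q * F"
  proof (rule fps_eq_if_eq_on_disc)
    show "(\<lambda>z. z * deriv f z) has_fps_expansion fps_X * fps_deriv F"
      by (intro fps_expansion_intros F)
    show "(\<lambda>z. q z * f z) has_fps_expansion Q * F"
      by (intro fps_expansion_intros F Q)
  qed (use ode_f in auto)
  have E2: "(1 + W) * fps_deriv Q = fps_const (of_real l) * fps_deriv W * Q"
  proof (rule fps_eq_if_eq_on_disc)
    show "(\<lambda>z. (1 + \<omega> z) * deriv q z) has_fps_expansion (1 + W) * fps_deriv Q"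
      by (intro fps_expansion_intros W Q)
    show "(\<lambda>z. of_real l * deriv \<omega> z * q z) has_fps_expansion
        fps_const (of_real l) * fps_deriv W * Q"
      by (intro fps_expansion_intros W Q)
  qed (use powr_of_bounded_holomorphic(2)[OF hol im] in \<open>auto simp: q_def[abs_def]\<close>)
  define c1 c2 c3 where "c1 = fps_nth W 1" and "c2 = fps_nth W 2" and "c3 = fps_nth W 3"
  define p1 p2 p3 where "p1 = fps_nth Q 1" and "p2 = fps_nth Q 2" and "p3 = fps_nth Q 3"
  define L :: complex where "L = of_real l"
  note nums = numeral_2_eq_2 numeral_3_eq_3
  note defs = c1_def c2_def c3_def p1_def p2_def p3_def L_def
  have p1: "p1 = L * c1"
    using arg_cong[OF E2, of "\<lambda>H. fps_nth H 0"] by (simp add: defs Q0 W0)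
  have "2 * p2 + c1 * p1 = L * (2 * c2 + c1 * p1)"
    using arg_cong[OF E2, of "\<lambda>H. fps_nth H 1"]
    by (simp add: defs Q0 W0 fps_mult_nth nums algebra_simps)
  then have p2: "p2 = (L * (2 * c2 + c1 * p1) - c1 * p1) / 2"
    by (simp add: field_simps)
  have "3 * p3 + 2 * c1 * p2 + c2 * p1 = L * (3 * c3 + 2 * c2 * p1 + c1 * p2)"
    using arg_cong[OF E2, of "\<lambda>H. fps_nth H 2"]
    by (simp add: defs Q0 W0 fps_mult_nth nums algebra_simps)
  then have p3: "p3 = (L * (3 * c3 + 2 * c2 * p1 + c1 * p2) - 2 * c1 * p2 - c2 * p1) / 3"
    by (simp add: field_simps)
  have a2: "a 2 = p1"
    using arg_cong[OF E1, of "\<lambda>H. fps_nth H 2"]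
    by (simp add: defs Q0 fps_mult_nth nums F_def algebra_simps)
  have "2 * a 3 = p2 + p1 * a 2"
    using arg_cong[OF E1, of "\<lambda>H. fps_nth H 3"]
    by (simp add: defs Q0 fps_mult_nth nums F_def algebra_simps)
  then have a3: "a 3 = (p2 + p1 * a 2) / 2"
    by (simp add: field_simps)
  have "3 * a 4 = p3 + p2 * a 2 + p1 * a 3"
    using arg_cong[OF E1, of "\<lambda>H. fps_nth H 4"]
    by (simp add: defs Q0 fps_mult_nth eval_nat_numeral F_def algebra_simps)
  then have a4: "a 4 = (p3 + p2 * a 2 + p1 * a 3) / 3"
    by (simp add: field_simps)
  have "a 2 * a 4 - (a 3)\<^sup>2 = L\<^sup>2 / 12 * (4 * c1 * c3 - 3 * c2\<^sup>2 + (L - 1) * (c1\<^sup>2 * c2)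
     + (1 + L) * (7 - 13 * L) / 12 * c1 ^ 4)"
    unfolding a4 a3 a2 p3 p2 p1 by (simp add: field_simps) algebra
  then show ?thesis
    by (simp add: hankel_numerator_def c1_def c2_def c3_def L_def)
qed

section \<open>The bound\<close>

text \<open>
  With $u = |c|$ and $v = |x|$, the triangle inequality leaves a polynomial in $v$ whose coefficients
  are nonnegative, the one of $v^2$ being $(1 - u^2)(1 - u)(3 - u)$; so $v$ may be replaced by $1$.
  The coefficient $K$ of $c^4$ satisfies $|K| \le 1$ for $0 < \lambda \le 1$.
\<close>

lemma hankel_numerator_bound:
  fixes c x y :: complex
  assumes l: "0 < l" "l \<le> 1" and c: "norm c \<le> 1" and x: "norm x \<le> 1" and y: "norm y \<le> 1"
  shows "norm (hankel_numerator l c (of_real (1 - (norm c)\<^sup>2) * x)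
     (of_real (1 - (norm c)\<^sup>2) * (of_real (1 - (norm x)\<^sup>2) * y - cnj c * x\<^sup>2))) \<le> 3"
proof -
  define u v where "u = norm c" and "v = norm x"
  define K where "K = (1 + l) * (7 - 13 * l) / 12"
  have u: "0 \<le> u" "u \<le> 1" and v: "0 \<le> v" "v \<le> 1"
    using c x by (auto simp: u_def v_def)
  have u2: "0 \<le> 1 - u\<^sup>2" and v2: "0 \<le> 1 - v\<^sup>2"
    using u v by (auto simp: power_le_one)
  have l2: "0 \<le> l\<^sup>2" "l\<^sup>2 \<le> 1"
    using l by (auto simp: power_le_one)
  have "12 * K = 7 - 6 * l - 13 * l\<^sup>2"
    by (simp add: K_def field_simps power2_eq_square)
  then have K: "\<bar>K\<bar> \<le> 1"
    using l l2 by linarith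
  define T1 where "T1 = 4 * c * (of_real (1 - u\<^sup>2) * (of_real (1 - v\<^sup>2) * y - cnj c * x\<^sup>2))"
  define T2 where "T2 = 3 * (of_real (1 - u\<^sup>2) * x)\<^sup>2"
  define T3 where "T3 = of_real (l - 1) * (c\<^sup>2 * (of_real (1 - u\<^sup>2) * x))"
  define T4 where "T4 = of_real K * c ^ 4"
  have "norm (of_real (1 - v\<^sup>2) * y - cnj c * x\<^sup>2) \<le> (1 - v\<^sup>2) * norm y + u * v\<^sup>2"
    by (rule order_trans[OF norm_triangle_ineq4])
      (simp only: norm_mult norm_power norm_of_real complex_mod_cnj u_def[symmetric]
        v_def[symmetric] abs_of_nonneg[OF v2] order_refl)
  also have "\<dots> \<le> (1 - v\<^sup>2) + u * v\<^sup>2"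
    using mult_left_le[OF y v2] by simp
  finally have in1: "norm (of_real (1 - v\<^sup>2) * y - cnj c * x\<^sup>2) \<le> (1 - v\<^sup>2) + u * v\<^sup>2" .
  have T1: "norm T1 \<le> 4 * u * ((1 - u\<^sup>2) * ((1 - v\<^sup>2) + u * v\<^sup>2))"
    unfolding T1_def norm_mult norm_of_real abs_of_nonneg[OF u2] u_def[symmetric]
    using mult_left_mono[OF mult_left_mono[OF in1 u2], of "4 * u"] u by simp
  have T2: "norm T2 = 3 * ((1 - u\<^sup>2) * v)\<^sup>2"
    unfolding T2_def norm_mult norm_power norm_of_real abs_of_nonneg[OF u2] v_def by simp
  have T3: "norm T3 = (1 - l) * (u\<^sup>2 * ((1 - u\<^sup>2) * v))"
    unfolding T3_def norm_mult norm_power norm_of_real abs_of_nonneg[OF u2] v_def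
    using l by (simp add: u_def)
  have T4: "norm T4 \<le> u ^ 4"
    unfolding T4_def norm_mult norm_power norm_of_real u_def[symmetric]
    using mult_right_mono[OF K, of "u ^ 4"] u by simp
  have "norm (T1 - T2 + T3 + T4) \<le> norm T1 + norm T2 + norm T3 + norm T4"
    by (smt (verit) norm_triangle_ineq norm_triangle_ineq4)
  also have "\<dots> \<le> (1 - u\<^sup>2) * (4 * u + v\<^sup>2 * ((1 - u) * (3 - u)) + (1 - l) * u\<^sup>2 * v) + u ^ 4"
    using T1 T2 T3 T4 by (simp add: algebra_simps power2_eq_square power4_eq_xxxx)
  also have "\<dots> \<le> (1 - u\<^sup>2) * (4 * u + 1 * ((1 - u) * (3 - u)) + (1 - l) * u\<^sup>2 * 1) + u ^ 4"
    using u v l u2 v2 by (intro add_mono mult_left_mono mult_right_mono mult_nonneg_nonneg) auto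
  also have "\<dots> = 3 - (1 + l) * u\<^sup>2 - (1 - l) * (u\<^sup>2)\<^sup>2"
    by (simp add: algebra_simps power2_eq_square power4_eq_xxxx)
  also have "\<dots> \<le> 3"
  proof -
    have "0 \<le> (1 + l) * u\<^sup>2" "0 \<le> (1 - l) * (u\<^sup>2)\<^sup>2"
      using l by (intro mult_nonneg_nonneg; simp)+
    then show ?thesis
      by linarith
  qed
  finally show ?thesis
    by (simp add: hankel_numerator_def T1_def T2_def T3_def T4_def K_def u_def v_def)
qed

lemma Hankel_determinant_bound:
  assumes l: "0 < l" "l \<le> 1" and f: "f \<in> class_ST_ss l" and a: "has_normalized_expansion f a"
  shows "norm (a 2 * a 4 - (a 3)\<^sup>2) \<le> l\<^sup>2 / 4"
proof -
  obtain \<omega> where hol: "\<omega> holomorphic_on unit_disc" and im: "\<omega> ` unit_disc \<subseteq> unit_disc"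
    and w0: "\<omega> 0 = 0"
    and sub: "\<And>z. z \<in> unit_disc \<Longrightarrow> starlike_quotient f z = (1 + \<omega> z) powr of_real l"
    and ST: "f \<in> class_ST"
    using f by (auto simp: class_ST_ss_def subordinate_def)
  define W where "W = fps_expansion \<omega> 0"
  have W: "\<omega> has_fps_expansion W"
    unfolding W_def by (rule has_fps_expansion_fps_expansion[OF _ _ hol]) auto
  have W0: "fps_nth W 0 = 0"
    using fps_nth_fps_expansion[OF W, of 0] w0 by simp
  obtain c x y :: complex where b: "norm c \<le> 1" "norm x \<le> 1" "norm y \<le> 1"
    and "fps_nth W 1 = c"
    and "fps_nth W 2 = of_real (1 - (norm c)\<^sup>2) * x"
    and "fps_nth W 3 = of_real (1 - (norm c)\<^sup>2) * (of_real (1 - (norm x)\<^sup>2) * y - cnj c * x\<^sup>2)"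
    using Schwarz_function_coefficients[OF hol im W W0] by blast
  then have "norm (hankel_numerator l (fps_nth W 1) (fps_nth W 2) (fps_nth W 3)) \<le> 3"
    using hankel_numerator_bound[OF l b] by simp
  then have "l\<^sup>2 / 12 * norm (hankel_numerator l (fps_nth W 1) (fps_nth W 2) (fps_nth W 3))
      \<le> l\<^sup>2 / 12 * 3"
    by (intro mult_left_mono) auto
  moreover have "a 2 * a 4 - (a 3)\<^sup>2 =
      of_real (l\<^sup>2 / 12) * hankel_numerator l (fps_nth W 1) (fps_nth W 2) (fps_nth W 3)"
    by (rule Hankel_determinant_formula[OF ST a hol im W W0 sub])
  then have "norm (a 2 * a 4 - (a 3)\<^sup>2) =
      l\<^sup>2 / 12 * norm (hankel_numerator l (fps_nth W 1) (fps_nth W 2) (fps_nth W 3))"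
    by (simp only: norm_mult norm_of_real) simp
  ultimately show ?thesis
    by simp
qed

section \<open>The extremal function\<close>

text \<open>
  The Noshiro--Warschawski criterion: along the segment from $a$ to $b$, the real part of
  $F/(b - a)$ has the derivative $\mathrm{Re}\, F' > 0$, hence takes different values at the ends.
\<close>

lemma inj_on_if_Re_deriv_pos:
  fixes F :: "complex \<Rightarrow> complex"
  assumes "convex S"
    and der: "\<And>z. z \<in> S \<Longrightarrow> (F has_field_derivative F' z) (at z)"
    and pos: "\<And>z. z \<in> S \<Longrightarrow> Re (F' z) > 0"
  shows "inj_on F S"
proof (rule inj_onI, rule ccontr)
  fix a b assume a: "a \<in> S" and b: "b \<in> S" and eq: "F a = F b" and "a \<noteq> b"
  define \<gamma> where "\<gamma> t = a + of_real t * (b - a)" for t :: real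
  have \<gamma>: "\<gamma> t \<in> S" if "0 \<le> t" "t \<le> 1" for t
    using convexD_alt[OF \<open>convex S\<close> a b that]
    by (simp add: \<gamma>_def algebra_simps scaleR_conv_of_real)
  have d: "((\<lambda>t. Re (F (\<gamma> t) / (b - a))) has_real_derivative Re (F' (\<gamma> t))) (at t)"
    if "0 \<le> t" "t \<le> 1" for t
  proof -
    have "(\<gamma> has_vector_derivative (b - a)) (at t)"
      unfolding \<gamma>_def by (auto intro!: derivative_eq_intros)
    then have "((F \<circ> \<gamma>) has_vector_derivative (b - a) * F' (\<gamma> t)) (at t)"
      by (rule field_vector_diff_chain_at) (rule der[OF \<gamma>[OF that]])
    then have "((\<lambda>t. (F \<circ> \<gamma>) t / (b - a)) has_vector_derivative
        (b - a) * F' (\<gamma> t) / (b - a)) (at t)"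
      by (rule has_vector_derivative_divide)
    then have "((\<lambda>t. F (\<gamma> t) / (b - a)) has_vector_derivative F' (\<gamma> t)) (at t)"
      using \<open>a \<noteq> b\<close> by (simp add: o_def)
    then show ?thesis
      unfolding has_real_derivative_iff_has_vector_derivative
      by (rule bounded_linear.has_vector_derivative[OF bounded_linear_Re])
  qed
  have "Re (F (\<gamma> 0) / (b - a)) < Re (F (\<gamma> 1) / (b - a))"
    by (rule DERIV_pos_imp_increasing) (use d pos \<gamma> in auto)
  then show False
    using eq by (simp add: \<gamma>_def)
qed

text \<open>
  The function $F(\zeta) = \zeta + g(e^\zeta)$ is a logarithm of $f(e^\zeta)$ for
  $f(z) = z \exp g(z)$, and it is injective on the left half plane. If $f$ takes the same value at
  two points, then the values of $F$ at their logarithms differ by some $2 \pi i n$; since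
  $F(\zeta + 2 \pi i n) = F(\zeta) + 2 \pi i n$, moving one logarithm to another branch makes them
  equal.
\<close>

lemma starlike_imp_inj_on:
  assumes g: "\<And>z. z \<in> unit_disc \<Longrightarrow> (g has_field_derivative g' z) (at z)"
    and pos: "\<And>z. z \<in> unit_disc \<Longrightarrow> Re (1 + z * g' z) > 0"
  shows "inj_on (\<lambda>z. z * exp (g z)) unit_disc"
proof (rule inj_onI)
  define H where "H = {\<zeta>::complex. Re \<zeta> < 0}"
  define F where "F \<zeta> = \<zeta> + g (exp \<zeta>)" for \<zeta>
  have H: "exp \<zeta> \<in> unit_disc \<longleftrightarrow> \<zeta> \<in> H" for \<zeta>
    by (simp add: H_def)
  have "inj_on F H"
  proof (rule inj_on_if_Re_deriv_pos)
    show "convex H"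
      unfolding H_def by (rule convex_halfspace_Re_lt)
    show "(F has_field_derivative 1 + exp \<zeta> * g' (exp \<zeta>)) (at \<zeta>)" if "\<zeta> \<in> H" for \<zeta>
      unfolding F_def using g[of "exp \<zeta>"] that H
      by (auto intro!: derivative_eq_intros DERIV_chain2[of g])
    show "Re (1 + exp \<zeta> * g' (exp \<zeta>)) > 0" if "\<zeta> \<in> H" for \<zeta>
      using pos[of "exp \<zeta>"] that H by blast
  qed
  fix z w assume z: "z \<in> unit_disc" and w: "w \<in> unit_disc"
    and eq: "z * exp (g z) = w * exp (g w)"
  show "z = w"
  proof (cases "z = 0 \<or> w = 0")
    case True
    then show ?thesis using eq by auto
  next
    case False
    then have zw: "exp (Ln z) = z" "exp (Ln w) = w"
      by auto
    then have "exp (F (Ln z)) = exp (F (Ln w))"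
      using eq by (simp add: F_def exp_add)
    then obtain n :: int where n: "F (Ln z) = F (Ln w) + of_int (2 * n) * pi * \<i>"
      by (auto simp: exp_eq)
    define \<zeta> where "\<zeta> = Ln w + of_int (2 * n) * pi * \<i>"
    have ez: "exp \<zeta> = w"
      unfolding \<zeta>_def using zw(2) exp_eq[of "Ln w + of_int (2 * n) * pi * \<i>" "Ln w"] by auto
    have "F (Ln z) = F \<zeta>"
      using n zw(2) ez by (simp add: F_def \<zeta>_def)
    moreover have "Ln z \<in> H" "\<zeta> \<in> H"
      using H[of "Ln z"] H[of \<zeta>] z w zw(1) ez by simp_all
    ultimately have "Ln z = \<zeta>"
      using \<open>inj_on F H\<close> by (auto dest: inj_onD)
    then show ?thesis
      using zw(1) ez by simp
  qed
qed

lemma Re_powr_pos: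
  assumes "Re w > 0" and l: "0 < l" "l \<le> 1"
  shows "Re (w powr of_real l) > 0"
proof -
  have w: "w \<noteq> 0" using assms(1) by auto
  have "\<bar>Im (Ln w)\<bar> < pi / 2"
    using assms(1) w Re_Ln_pos_lt by blast
  moreover have "\<bar>l * Im (Ln w)\<bar> \<le> 1 * \<bar>Im (Ln w)\<bar>"
    unfolding abs_mult using l by (intro mult_right_mono) auto
  ultimately have "cos (l * Im (Ln w)) > 0"
    by (intro cos_gt_zero_pi) auto
  then show ?thesis
    using w by (simp add: powr_def Re_exp)
qed

text \<open>
  The equation $z f' = q f$ is solved by $f(z) = z \exp g(z)$ with $g' = (q - 1)/z$, where the
  quotient extends holomorphically to the origin because $q(0) = 1$.
\<close>

lemma starlike_function_exists:
  assumes q: "q holomorphic_on unit_disc" and q0: "q 0 = 1"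
    and pos: "\<And>z. z \<in> unit_disc \<Longrightarrow> Re (q z) > 0"
  obtains f where "f \<in> class_ST" and "\<And>z. z \<in> unit_disc \<Longrightarrow> starlike_quotient f z = q z"
proof -
  have "(\<lambda>z. q z - 1) holomorphic_on ball 0 1"
    by (intro holomorphic_intros q)
  then obtain h where h: "h holomorphic_on unit_disc"
    and qh: "\<And>z. norm z < 1 \<Longrightarrow> q z - 1 = z * h z"
    using Schwarz3[of "\<lambda>z. q z - 1" 1] q0 by auto
  obtain g0 where g0: "\<And>z. z \<in> unit_disc \<Longrightarrow> (g0 has_field_derivative h z) (at z within unit_disc)"
    using holomorphic_convex_primitive'[OF _ _ h] by auto
  define g where "g z = g0 z - g0 0" for z
  define f where "f z = z * exp (g z)" for z
  have g: "(g has_field_derivative h z) (at z)" if "z \<in> unit_disc" for z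
    using g0[OF that] that at_within_open[OF that] unfolding g_def
    by (auto intro!: derivative_eq_intros)
  have qh': "q z = 1 + z * h z" if "z \<in> unit_disc" for z
    using qh[of z] that by (simp add: algebra_simps)
  have df: "(f has_field_derivative exp (g z) * q z) (at z)" if "z \<in> unit_disc" for z
    unfolding f_def qh'[OF that]
    by (rule derivative_eq_intros g[OF that] refl)+ (simp add: algebra_simps)
  have fhol: "f holomorphic_on unit_disc"
    using df unfolding holomorphic_on_open[OF open_ball] by blast
  have quot: "starlike_quotient f z = q z" if z: "z \<in> unit_disc" for z
    using DERIV_imp_deriv[OF df[OF z]] q0 by (simp add: starlike_quotient_def f_def)
  have "has_normalized_expansion f (\<lambda>n. (deriv ^^ n) f 0 / fact n)"
    unfolding has_normalized_expansion_def
  proof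
    fix z :: complex assume z: "z \<in> unit_disc"
    have "(\<lambda>n. (deriv ^^ n) f 0 / fact n * z ^ n) sums f z"
      using holomorphic_power_series[OF fhol z] by simp
    from sums_split_initial_segment[OF this, of 2]
    have "(\<lambda>n. (deriv ^^ (n + 2)) f 0 / fact (n + 2) * z ^ (n + 2)) sums
        (f z - (\<Sum>i<2. (deriv ^^ i) f 0 / fact i * z ^ i))" .
    moreover have "f 0 = 0" "deriv f 0 = 1"
      using DERIV_imp_deriv[OF df, of 0] q0 by (simp_all add: f_def g_def)
    then have "(\<Sum>i<2. (deriv ^^ i) f 0 / fact i * z ^ i) = z"
      by (simp add: numeral_2_eq_2)
    ultimately show "(\<lambda>n. (deriv ^^ (n + 2)) f 0 / fact (n + 2) * z ^ (n + 2)) sums (f z - z)"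
      by simp
  qed
  moreover have "inj_on f unit_disc"
    unfolding f_def using starlike_imp_inj_on[OF g] pos qh' by simp
  ultimately have "f \<in> class_ST"
    using fhol quot pos by (auto simp: class_ST_def class_A_def)
  then show ?thesis
    using that quot by blast
qed

text \<open>
  For $\omega(z) = z^2$ one has $c_1 = c_3 = 0$ and $c_2 = 1$, so only the term $-3 c_2^2$ of the
  bracket survives.
\<close>

lemma Hankel_determinant_bound_attained:
  assumes l: "0 < l" "l \<le> 1"
  obtains f a where "f \<in> class_ST_ss l" "has_normalized_expansion f a"
    "norm (a 2 * a 4 - (a 3)\<^sup>2) = l\<^sup>2 / 4"
proof -
  define \<omega> :: "complex \<Rightarrow> complex" where "\<omega> z = z ^ 2" for z
  define q where "q z = (1 + \<omega> z) powr of_real l" for z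
  have hol: "\<omega> holomorphic_on unit_disc"
    unfolding \<omega>_def by (intro holomorphic_intros)
  have im: "\<omega> ` unit_disc \<subseteq> unit_disc"
    by (auto simp: \<omega>_def norm_power power_less_one_iff)
  have W: "\<omega> has_fps_expansion fps_X ^ 2"
    unfolding \<omega>_def by (intro fps_expansion_intros)
  have "Re (1 + \<omega> z) > 0" if "z \<in> unit_disc" for z
    using im that abs_Re_le_cmod[of "\<omega> z"] by (force simp: image_subset_iff)
  then have pos: "Re (q z) > 0" if "z \<in> unit_disc" for z
    unfolding q_def using Re_powr_pos l that by blast
  have "q holomorphic_on unit_disc"
    using powr_of_bounded_holomorphic(1)[OF hol im] by (simp add: q_def[abs_def])
  then obtain f where f: "f \<in> class_ST"
    and quot: "\<And>z. z \<in> unit_disc \<Longrightarrow> starlike_quotient f z = q z"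
    using starlike_function_exists[of q] pos by (auto simp: q_def \<omega>_def)
  obtain a where a: "has_normalized_expansion f a"
    using f by (auto simp: class_ST_def class_A_def)
  have "f \<in> class_ST_ss l"
    using f hol im quot unfolding class_ST_ss_def subordinate_def
    by (auto intro!: exI[of _ \<omega>] simp: q_def) (simp add: \<omega>_def)
  moreover have "a 2 * a 4 - (a 3)\<^sup>2 = of_real (l\<^sup>2 / 12) * (- 3)"
    using Hankel_determinant_formula[OF f a hol im W, of l] quot
    by (simp add: q_def hankel_numerator_def fps_X_power_nth)
  then have "norm (a 2 * a 4 - (a 3)\<^sup>2) = l\<^sup>2 / 4"
    by (simp only: norm_mult norm_of_real) simp
  ultimately show ?thesis
    using that a by blast
qed

theorem theorem5p2:
  fixes l :: real
  assumes "0 < l" and "l \<le> 1"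
  shows "(\<forall>f a. f \<in> class_ST_ss l \<and> has_normalized_expansion f a \<longrightarrow>
             norm (a 2 * a 4 - (a 3)\<^sup>2) \<le> l\<^sup>2 / 4) \<and>
         (\<forall>B::real. (\<forall>f a. f \<in> class_ST_ss l \<and> has_normalized_expansion f a \<longrightarrow>
             norm (a 2 * a 4 - (a 3)\<^sup>2) \<le> B) \<longrightarrow> l\<^sup>2 / 4 \<le> B)"
  using Hankel_determinant_bound[OF assms] Hankel_determinant_bound_attained[OF assms]
  by metis

end
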